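(* Let $S>0$ and suppose that $x,u:[0,\infty)\times[0,S]\to\mathbb{R}$ are obtained from a continuous function $\theta:[0,\infty)\times[0,S]\to\mathbb{R}$ by $$x(\tau,s)=x(\tau,0)+\int_0^s\cos\theta(\tau,\sigma)\,\mathrm{d}\sigma,\qquad u(\tau,s)=u(\tau,0)+\int_0^s\sin\theta(\tau,\sigma)\,\mathrm{d}\sigma .$$ Then $\mathcal{L}(x(\tau),u(\tau))=-\mathcal{H}(\theta(\tau))$ for any $\tau\in[0,\infty)$, where $\mathcal{L}:C[0,S]\times C[0,S]\to\mathbb{R}$ is defined by $\mathcal{L}(f,g):=f(S)-f(0)$ for $f,g\in C[0,S]$.
   Context: $\mathcal{H}(\theta(\tau))=-\int_0^S\cos\theta(\tau,s)\,\mathrm{d}s$. For a function $f$ of $(\tau,s)$, $f(\tau)$ denotes the function $s\mapsto f(\tau,s)$ on $[0,S]$. The base point $(x(\tau,0),u(\tau,0))$ is arbitrary. *)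

theory Defs
  imports "HOL-Analysis.Analysis" "HOL-Library.FuncSet"
begin

(* C[0,S].  An element is represented by a function on all of real; its values outside
   [0,S] are irrelevant to everything below. *)
definition C_interval :: "real \<Rightarrow> (real \<Rightarrow> real) set" where
  "C_interval S = {f. continuous_on {0..S} f}"

(* restrict makes C[0,S] x C[0,S] the actual domain: outside it the value is undefined,
   so evaluating curve_L at (f, g) requires f and g to be continuous on [0,S]. *)
definition curve_L :: "real \<Rightarrow> (real \<Rightarrow> real) \<times> (real \<Rightarrow> real) \<Rightarrow> real" where
  "curve_L S = restrict (\<lambda>(f, g). f S - f 0) (C_interval S \<times> C_interval S)"

definition curve_H :: "real \<Rightarrow> (real \<Rightarrow> real) \<Rightarrow> real" where
  "curve_H S \<phi> = - integral {0..S} (\<lambda>s. cos (\<phi> s))"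

end

theory Submission
  imports Defs
begin

text \<open>The increment \<open>x(\<tau>, S) - x(\<tau>, 0)\<close> is the integral of \<open>cos \<theta>\<close> over \<open>[0,S]\<close> by the
  representation of \<open>x\<close> at \<open>s = S\<close>, and this is \<open>- curve_H\<close>.  What has to be proved is that
  \<open>curve_L\<close> may be evaluated: \<open>x(\<tau>)\<close> and \<open>u(\<tau>)\<close> must be continuous on \<open>[0,S]\<close>.  They are, being
  indefinite integrals of the continuous functions \<open>cos \<theta>(\<tau>)\<close> and \<open>sin \<theta>(\<tau>)\<close>.\<close>

text \<open>Both coordinates of the curve reach \<open>C[0,S]\<close> in the same way, so the
  integrand is kept general here.\<close>

lemma indefinite_integral_in_C_interval:
  fixes f g :: "real \<Rightarrow> real"
  assumes "continuous_on {0..S} g"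
    and "\<And>s. s \<in> {0..S} \<Longrightarrow> f s = f 0 + integral {0..s} g"
  shows "f \<in> C_interval S"
proof -
  have "continuous_on {0..S} (\<lambda>s. f 0 + integral {0..s} g)"
    using assms(1)
    by (intro continuous_intros indefinite_integral_continuous_1 integrable_continuous_interval)
  then have "continuous_on {0..S} f"
    by (rule continuous_on_eq) (rule assms(2)[symmetric])
  then show ?thesis
    by (simp add: C_interval_def)
qed

theorem lemma2p6:
  fixes S :: real and x u \<theta> :: "real \<Rightarrow> real \<Rightarrow> real"
  assumes "S > 0"
    and "continuous_on ({0..} \<times> {0..S}) (\<lambda>(\<tau>, s). \<theta> \<tau> s)"
    and "\<And>\<tau> s. \<tau> \<in> {0..} \<Longrightarrow> s \<in> {0..S} \<Longrightarrow>
           x \<tau> s = x \<tau> 0 + integral {0..s} (\<lambda>\<sigma>. cos (\<theta> \<tau> \<sigma>))"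
    and "\<And>\<tau> s. \<tau> \<in> {0..} \<Longrightarrow> s \<in> {0..S} \<Longrightarrow>
           u \<tau> s = u \<tau> 0 + integral {0..s} (\<lambda>\<sigma>. sin (\<theta> \<tau> \<sigma>))"
  shows "\<forall>\<tau>\<in>{0..}. curve_L S (x \<tau>, u \<tau>) = - curve_H S (\<theta> \<tau>)"
proof
  fix \<tau> :: real
  assume \<tau>: "\<tau> \<in> {0..}"
  have slice: "continuous_on {0..S} (\<lambda>s. \<theta> \<tau> s)"
  proof -
    have "continuous_on {0..S} (\<lambda>s. (\<lambda>(\<tau>, s). \<theta> \<tau> s) (\<tau>, s))"
      using \<tau> by (intro continuous_on_compose2[OF assms(2)] continuous_intros) auto
    then show ?thesis
      by simp
  qed
  have "x \<tau> \<in> C_interval S"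
    by (rule indefinite_integral_in_C_interval[OF continuous_on_cos[OF slice] assms(3)[OF \<tau>]])
  moreover have "u \<tau> \<in> C_interval S"
    by (rule indefinite_integral_in_C_interval[OF continuous_on_sin[OF slice] assms(4)[OF \<tau>]])
  ultimately have "curve_L S (x \<tau>, u \<tau>) = x \<tau> S - x \<tau> 0"
    by (simp add: curve_L_def)
  also have "\<dots> = integral {0..S} (\<lambda>\<sigma>. cos (\<theta> \<tau> \<sigma>))"
    using assms(3)[OF \<tau>, of S] \<open>S > 0\<close> by simp
  finally show "curve_L S (x \<tau>, u \<tau>) = - curve_H S (\<theta> \<tau>)"
    by (simp add: curve_H_def)
qed

end
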